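(* Let $A\in\mathbb{R}^{m\times n}$ with $\operatorname{rank}(A)=n$, let $b\in\mathbb{R}^m$, let $R_s\in\mathbb{R}^{n\times n}$ be nonsingular, and set $A_p\equiv AR_s^{-1}$. Let $x_*\in\mathbb{R}^n$ be the exact solution of the half-preconditioned normal equations $A_p^TAx_*=A_p^Tb$. Let $E_s\in\mathbb{R}^{n\times n}$ and $E_A\in\mathbb{R}^{m\times n}$ with $\|E_s\|\,\|R_s^{-1}\|<1$, and set $$A_1\equiv (A+E_A)(R_s+E_s)^{-1},\qquad A_2\equiv A+E_A,\qquad \epsilon_s\equiv\frac{\|E_s\|}{\|R_s\|},\qquad \epsilon_A\equiv\frac{\|E_A\|}{\|A\|}.$$ Let the computed solution $\hat x\in\mathbb{R}^n$ satisfy $$A_1^TA_2\hat x=A_1^Tb.$$ If $\hat x\neq 0$, then $$\frac{\|\hat x-x_*\|}{\|\hat x\|}\leq \kappa(A_p^TA)\,\nu\,\epsilon_A\left(\kappa(R_s)\,\frac{\|A\hat x-b\|}{\|A\|\,\|\hat x\|}+1+\kappa(A)\,\epsilon_A\right),$$ where $$\nu\equiv\frac{\|A_p\|\,\|A\|}{\|A_p^TA\|}\geq 1.$$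
   Context: $\|\cdot\|$ denotes the Euclidean two-norm (for matrices, the induced spectral norm). For a real matrix $M$ of full column rank, $M^\dagger\equiv(M^TM)^{-1}M^T$ is the Moore-Penrose inverse and $\kappa(M)\equiv\|M\|\,\|M^\dagger\|$ is the two-norm condition number with respect to left inversion (for nonsingular square $M$, $M^\dagger=M^{-1}$). *)

theory Defs
  imports "HOL-Analysis.Analysis"
begin

text \<open>The type-class \<open>norm\<close> on \<^typ>\<open>real^'n^'m\<close> is the Frobenius norm, hence a separate
  constant for the matrix norm induced by the Euclidean norm.\<close>

definition spectral_norm :: "real^'n^'m \<Rightarrow> real"
  where "spectral_norm M = onorm (\<lambda>x. M *v x)"

text \<open>Only meaningful for matrices of full column rank; otherwise \<^const>\<open>matrix_inv\<close> is applied
  to a singular matrix and its value is unspecified.\<close>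

definition pinv :: "real^'n^'m \<Rightarrow> real^'m^'n"
  where "pinv M = matrix_inv (transpose M ** M) ** transpose M"

definition cond_num :: "real^'n^'m \<Rightarrow> real"
  where "cond_num M = spectral_norm M * spectral_norm (pinv M)"

lemma pinv_eq_matrix_inv:
  fixes M :: "real^'n^'n"
  assumes "invertible M"
  shows "pinv M = matrix_inv M"
proof -
  have inv: "invertible (transpose M ** M)"
    using assms by (simp add: invertible_mult transpose_invertible)
  have r: "M ** matrix_inv M = mat 1"
    using assms unfolding invertible_def matrix_inv_def
    by (metis (mono_tags, lifting) someI_ex)
  have l: "matrix_inv (transpose M ** M) ** (transpose M ** M) = mat 1"
    using inv unfolding invertible_def matrix_inv_def
    by (metis (mono_tags, lifting) someI_ex)
  have "pinv M = pinv M ** (M ** matrix_inv M)"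
    by (simp add: r)
  also have "\<dots> = (matrix_inv (transpose M ** M) ** (transpose M ** M)) ** matrix_inv M"
    by (simp add: pinv_def matrix_mul_assoc)
  finally show ?thesis
    by (simp only: l matrix_mul_lid)
qed

end

theory Submission
  imports Defs
begin

text \<open>Since \<open>R\<^sub>s + E\<^sub>s\<close> is nonsingular, the perturbed equations are equivalent to
  \<open>(A + E\<^sub>A)\<^sup>T ((A + E\<^sub>A) xh - b) = 0\<close>. Multiplying by the transpose of \<open>R\<^sub>s\<^sup>-\<^sup>1\<close> and subtracting the
  exact equations expresses \<open>A\<^sub>p\<^sup>T A (xh - x)\<close> by three terms, which are bounded separately; the
  factorisations \<open>A = A\<^sub>p R\<^sub>s\<close> and \<open>R\<^sub>s\<^sup>-\<^sup>1 = A\<^sup>\<dagger> A\<^sub>p\<close> turn these bounds into condition numbers.\<close>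

section \<open>Spectral norm: submultiplicativity, transposition, positivity\<close>

lemma spectral_norm_bound: "norm (M *v x) \<le> spectral_norm M * norm x"
  unfolding spectral_norm_def by (rule onorm) simp

lemma spectral_norm_leI:
  assumes "0 \<le> c" "\<And>x. norm (M *v x) \<le> c * norm x"
  shows "spectral_norm M \<le> c"
  unfolding spectral_norm_def using assms by (rule onorm_bound)

lemma spectral_norm_nonneg: "0 \<le> spectral_norm M"
  unfolding spectral_norm_def by (rule onorm_pos_le) simp

lemma spectral_norm_mult: "spectral_norm (M ** N) \<le> spectral_norm M * spectral_norm N"
proof (rule spectral_norm_leI)
  fix x
  have "norm ((M ** N) *v x) \<le> spectral_norm M * norm (N *v x)"
    by (metis matrix_vector_mul_assoc spectral_norm_bound)
  also have "\<dots> \<le> spectral_norm M * (spectral_norm N * norm x)"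
    by (intro mult_left_mono spectral_norm_bound spectral_norm_nonneg)
  finally show "norm ((M ** N) *v x) \<le> spectral_norm M * spectral_norm N * norm x"
    by (simp add: mult.assoc)
qed (simp add: spectral_norm_nonneg)

lemma inner_transpose: "(transpose M *v y) \<bullet> x = y \<bullet> (M *v x)"
  for M :: "real^'n^'m"
  by (simp add: dot_lmul_matrix)

text \<open>The squared norm of \<open>?z = transpose M *v y\<close> equals the inner product of
  \<open>y\<close> with \<open>M *v ?z\<close>, so Cauchy-Schwarz and the bound for \<open>M\<close>
  leave a spare factor \<open>norm ?z\<close> to cancel. Since transposition is an involution, this
  one inequality gives equality.\<close>

lemma spectral_norm_transpose_le: "spectral_norm (transpose M) \<le> spectral_norm M"
proof (rule spectral_norm_leI)
  fix y
  let ?z = "transpose M *v y"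
  have "norm ?z * norm ?z = y \<bullet> (M *v ?z)"
    by (metis inner_transpose norm_eq_sqrt_inner real_sqrt_mult_self abs_of_nonneg inner_ge_zero)
  also have "\<dots> \<le> norm y * norm (M *v ?z)"
    by (rule norm_cauchy_schwarz)
  also have "\<dots> \<le> norm y * (spectral_norm M * norm ?z)"
    by (intro mult_left_mono spectral_norm_bound norm_ge_zero)
  finally have "norm ?z * norm ?z \<le> (spectral_norm M * norm y) * norm ?z"
    by (simp only: ac_simps)
  then show "norm ?z \<le> spectral_norm M * norm y"
    \<comment> \<open>Cancelling \<open>norm ?z\<close> requires it to be nonzero; if it vanishes,
      the right-hand side is nonnegative anyway.\<close>
    by (cases "norm ?z = 0")
      (auto simp: spectral_norm_nonneg simp del: transpose_matrix_vector)
qed (rule spectral_norm_nonneg)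

lemma spectral_norm_transpose: "spectral_norm (transpose M) = spectral_norm M"
  using spectral_norm_transpose_le[of M] spectral_norm_transpose_le[of "transpose M"] by simp

lemma spectral_norm_pos:
  fixes M :: "real^'n^'m"
  assumes "inj ((*v) M)"
  shows "0 < spectral_norm M"
proof (rule ccontr)
  assume "\<not> 0 < spectral_norm M"
  then have "spectral_norm M = 0"
    using spectral_norm_nonneg[of M] by linarith
  \<comment> \<open>The all-ones vector \<open>1\<close> serves as a nonzero vector, which a zero
    operator norm would send to \<open>0\<close>.\<close>
  then have "M *v 1 = M *v 0"
    using spectral_norm_bound[of M 1] by simp
  then show False
    using assms by (metis injD zero_neq_one)
qed

section \<open>Inverses, left inverses and perturbed inverses\<close>

lemma matrix_inv_left: "invertible M \<Longrightarrow> matrix_inv M ** M = mat 1"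
  and matrix_inv_right: "invertible M \<Longrightarrow> M ** matrix_inv M = mat 1"
  unfolding invertible_def matrix_inv_def by (metis (mono_tags, lifting) someI_ex)+

lemma invertible_iff_inj: "invertible M \<longleftrightarrow> inj ((*v) M)"
  for M :: "real^'n^'n"
  by (simp add: invertible_left_inverse matrix_left_invertible_injective)

text \<open>A kernel vector \<open>x\<close> of the Gram matrix satisfies
  \<open>(M *v x) \<bullet> (M *v x) = 0\<close>, so \<open>M *v x = 0\<close>; for a square matrix
  a trivial kernel suffices.\<close>

lemma invertible_gram:
  fixes M :: "real^'n^'m"
  assumes "inj ((*v) M)"
  shows "invertible (transpose M ** M)"
proof -
  have "x = 0" if "(transpose M ** M) *v x = 0" for x
  proof -
    have "(transpose M *v (M *v x)) \<bullet> x = 0"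
      using that by (simp only: matrix_vector_mul_assoc inner_zero_left)
    then have "M *v x = 0"
      by (simp only: inner_transpose inner_eq_zero_iff)
    then show "x = 0"
      using assms by (metis injD matrix_vector_mult_0_right)
  qed
  then show ?thesis
    unfolding invertible_left_inverse matrix_left_invertible_ker by blast
qed

lemma pinv_left_inverse: "inj ((*v) M) \<Longrightarrow> pinv M ** M = mat 1"
  for M :: "real^'n^'m"
  by (simp add: pinv_def invertible_gram matrix_inv_left flip: matrix_mul_assoc)

text \<open>A nonzero kernel vector \<open>x\<close> of \<open>M + E\<close> would be a fixed point
  of \<open>- (matrix_inv M ** E)\<close>, whose norm is below 1, and so would be strictly shorter
  than itself.\<close>

lemma invertible_perturbation:
  fixes M E :: "real^'n^'n"
  assumes M: "invertible M" and small: "spectral_norm E * spectral_norm (matrix_inv M) < 1"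
  shows "invertible (M + E)"
proof -
  have "x = 0" if "(M + E) *v x = 0" for x
  proof (rule ccontr)
    assume "x \<noteq> 0"
    from that have "M *v x = - (E *v x)"
      by (simp add: matrix_vector_mult_add_rdistrib eq_neg_iff_add_eq_0)
    then have "matrix_inv M *v (M *v x) = matrix_inv M *v (- (E *v x))"
      by simp
    then have "norm x = norm (matrix_inv M *v (- (E *v x)))"
      by (simp add: matrix_vector_mul_assoc matrix_inv_left M)
    also have "\<dots> \<le> spectral_norm (matrix_inv M) * norm (E *v x)"
      using spectral_norm_bound[of "matrix_inv M" "- (E *v x)"] by simp
    also have "\<dots> \<le> spectral_norm (matrix_inv M) * (spectral_norm E * norm x)"
      by (intro mult_left_mono spectral_norm_bound spectral_norm_nonneg)
    also have "\<dots> = spectral_norm E * spectral_norm (matrix_inv M) * norm x"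
      by (simp only: ac_simps)
    also have "\<dots> < norm x"
      using small \<open>x \<noteq> 0\<close> by simp
    finally show False by simp
  qed
  then show ?thesis
    unfolding invertible_left_inverse matrix_left_invertible_ker by blast
qed

section \<open>Perturbed normal equations\<close>

lemma transpose_add: "transpose (M + N) = transpose M + transpose N"
  by (simp add: transpose_def vec_eq_iff)

text \<open>Here \<open>P\<close> stands for the inverse of \<open>R\<^sub>s\<close>, so that
  \<open>A ** P\<close> is \<open>A\<^sub>p\<close>. The perturbed residual is
  \<open>?r + ?s\<close>; expanding its product with the transpose of
  \<open>(A + E\<^sub>A) ** P\<close> gives four terms, one of which carries the error.\<close>

lemma normal_equations_perturbation:
  fixes A E\<^sub>A :: "real^'n^'m" and P :: "real^'n^'n"
  assumes exact: "(transpose (A ** P) ** A) *v x = transpose (A ** P) *v b"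
    and perturbed: "transpose (A + E\<^sub>A) *v ((A + E\<^sub>A) *v xh - b) = 0"
  shows "(transpose (A ** P) ** A) *v (xh - x)
    = - (transpose (A ** P) *v (E\<^sub>A *v xh) + transpose (E\<^sub>A ** P) *v (A *v xh - b)
        + transpose (E\<^sub>A ** P) *v (E\<^sub>A *v xh))"
proof -
  let ?r = "A *v xh - b" and ?s = "E\<^sub>A *v xh"
  have "(A + E\<^sub>A) *v xh - b = ?r + ?s"
    by (simp add: matrix_vector_mult_add_rdistrib)
  then have "transpose P *v (transpose (A + E\<^sub>A) *v (?r + ?s)) = 0"
    using perturbed by (simp only: matrix_vector_mult_0_right)
  then have "(transpose (A ** P) *v ?r + transpose (E\<^sub>A ** P) *v ?r)
      + (transpose (A ** P) *v ?s + transpose (E\<^sub>A ** P) *v ?s) = 0"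
    by (simp only: transpose_add matrix_transpose_mul matrix_vector_mul_assoc[symmetric]
        matrix_vector_mult_add_rdistrib matrix_vector_right_distrib)
  \<comment> \<open>The exact equations trade \<open>x\<close> for \<open>b\<close>, which turns the
    error into the residual \<open>?r\<close> of the unperturbed problem.\<close>
  moreover have "(transpose (A ** P) ** A) *v (xh - x) = transpose (A ** P) *v ?r"
    by (simp only: matrix_vector_mult_diff_distrib exact matrix_vector_mul_assoc)
  ultimately show ?thesis
    by (simp only: eq_neg_iff_add_eq_0 ac_simps)
qed

lemma normal_equations_error_bound:
  fixes A E\<^sub>A :: "real^'n^'m" and P :: "real^'n^'n"
  assumes inj: "inj ((*v) (transpose (A ** P) ** A))"
    and exact: "(transpose (A ** P) ** A) *v x = transpose (A ** P) *v b"
    and perturbed: "transpose (A + E\<^sub>A) *v ((A + E\<^sub>A) *v xh - b) = 0"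
  shows "norm (xh - x) \<le> spectral_norm (pinv (transpose (A ** P) ** A)) * spectral_norm E\<^sub>A
    * (spectral_norm (A ** P) * norm xh
      + spectral_norm P * (norm (A *v xh - b) + spectral_norm E\<^sub>A * norm xh))"
proof -
  let ?B = "transpose (A ** P) ** A" and ?e = "spectral_norm E\<^sub>A"
  let ?r = "A *v xh - b" and ?s = "E\<^sub>A *v xh"
  have bound: "norm (transpose M *v y) \<le> spectral_norm M * norm y" for M :: "real^'n^'m" and y
    by (metis spectral_norm_bound spectral_norm_transpose)
  have s: "norm ?s \<le> ?e * norm xh"
    by (rule spectral_norm_bound)
  have 1: "norm (transpose (A ** P) *v ?s) \<le> spectral_norm (A ** P) * (?e * norm xh)"
    by (intro order_trans[OF bound] mult_left_mono s spectral_norm_nonneg)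
  \<comment> \<open>The product \<open>E\<^sub>A ** P\<close> is split so that the norm of
    \<open>E\<^sub>A\<close> becomes a common factor of all three terms; \<open>A ** P\<close> stays
    whole because its norm enters \<open>\<nu>\<close>.\<close>
  have EP: "norm (transpose (E\<^sub>A ** P) *v y) \<le> ?e * spectral_norm P * norm y" for y
    by (intro order_trans[OF bound] mult_right_mono spectral_norm_mult norm_ge_zero)
  have 2: "norm (transpose (E\<^sub>A ** P) *v ?s) \<le> ?e * spectral_norm P * (?e * norm xh)"
    by (intro order_trans[OF EP] mult_left_mono s mult_nonneg_nonneg spectral_norm_nonneg)
  have "norm (xh - x) = norm (pinv ?B *v (?B *v (xh - x)))"
    by (simp only: matrix_vector_mul_assoc pinv_left_inverse[OF inj] matrix_vector_mul_lid)
  also have "\<dots> \<le> spectral_norm (pinv ?B) * norm (?B *v (xh - x))"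
    by (rule spectral_norm_bound)
  also have "\<dots> \<le> spectral_norm (pinv ?B) * (norm (transpose (A ** P) *v ?s)
      + norm (transpose (E\<^sub>A ** P) *v ?r) + norm (transpose (E\<^sub>A ** P) *v ?s))"
    unfolding normal_equations_perturbation[OF exact perturbed] norm_minus_cancel
    by (intro mult_left_mono norm_triangle_le add_mono norm_triangle_ineq order_refl
        spectral_norm_nonneg)
  also have "\<dots> \<le> spectral_norm (pinv ?B) * (spectral_norm (A ** P) * (?e * norm xh)
      + ?e * spectral_norm P * norm ?r + ?e * spectral_norm P * (?e * norm xh))"
    by (intro mult_left_mono add_mono 1 2 EP spectral_norm_nonneg)
  finally show ?thesis
    by (simp add: algebra_simps)
qed

section \<open>The relative error bound in terms of condition numbers\<close>

theorem theorem4p2: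
  fixes A A\<^sub>1 A\<^sub>2 A\<^sub>p E\<^sub>A :: "real^'n^'m"
    and R\<^sub>s E\<^sub>s :: "real^'n^'n"
    and b :: "real^'m"
    and x xh :: "real^'n"
    and \<epsilon>\<^sub>s \<epsilon>\<^sub>A \<nu> :: real
  assumes "rank A = CARD('n)"
    and "invertible R\<^sub>s"
    and "A\<^sub>p = A ** matrix_inv R\<^sub>s"
    and "(transpose A\<^sub>p ** A) *v x = transpose A\<^sub>p *v b"
    and "spectral_norm E\<^sub>s * spectral_norm (matrix_inv R\<^sub>s) < 1"
    and "A\<^sub>1 = (A + E\<^sub>A) ** matrix_inv (R\<^sub>s + E\<^sub>s)"
    and "A\<^sub>2 = A + E\<^sub>A"
    and "\<epsilon>\<^sub>s = spectral_norm E\<^sub>s / spectral_norm R\<^sub>s"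
    and "\<epsilon>\<^sub>A = spectral_norm E\<^sub>A / spectral_norm A"
    and "(transpose A\<^sub>1 ** A\<^sub>2) *v xh = transpose A\<^sub>1 *v b"
    and "\<nu> = spectral_norm A\<^sub>p * spectral_norm A / spectral_norm (transpose A\<^sub>p ** A)"
  shows "(xh \<noteq> 0 \<longrightarrow>
           norm (xh - x) / norm xh
             \<le> cond_num (transpose A\<^sub>p ** A) * \<nu> * \<epsilon>\<^sub>A *
                (cond_num R\<^sub>s * (norm (A *v xh - b) / (spectral_norm A * norm xh))
                  + 1 + cond_num A * \<epsilon>\<^sub>A)) \<and> \<nu> \<ge> 1"
proof -
  note rank = assms(1) and R = assms(2) and Ap = assms(3) and x = assms(4) and small = assms(5)
    and A1 = assms(6) and A2 = assms(7) and epsA = assms(9) and xh = assms(10) and nu = assms(11)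
  let ?P = "matrix_inv R\<^sub>s" and ?B = "transpose A\<^sub>p ** A"
  let ?a = "spectral_norm A" and ?p = "spectral_norm A\<^sub>p" and ?e = "spectral_norm E\<^sub>A"
  let ?c = "spectral_norm (pinv ?B)" and ?t = "norm (A *v xh - b)"
  have injA: "inj ((*v) A)"
    using rank by (simp add: full_rank_injective)
  have "invertible ?P"
    unfolding invertible_def using R matrix_inv_left matrix_inv_right by blast
  \<comment> \<open>This regrouping of \<open>?B\<close> exhibits it as a product of two nonsingular
    square matrices.\<close>
  then have "invertible (transpose ?P ** (transpose A ** A))"
    by (intro invertible_mult transpose_invertible invertible_gram injA)
  then have injB: "inj ((*v) ?B)"
    by (simp add: invertible_iff_inj Ap matrix_transpose_mul matrix_mul_assoc)
  have a: "0 < ?a"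
    by (rule spectral_norm_pos[OF injA])
  have B: "0 < spectral_norm ?B"
    by (rule spectral_norm_pos[OF injB])
  have nu1: "\<nu> \<ge> 1"
    using spectral_norm_mult[of "transpose A\<^sub>p" A] B by (simp add: nu spectral_norm_transpose)
  \<comment> \<open>Undoing the perturbed preconditioner removes \<open>E\<^sub>s\<close> from the
    equations, so it does not appear in the final bound.\<close>
  have "A\<^sub>1 ** (R\<^sub>s + E\<^sub>s) = A + E\<^sub>A"
    by (simp add: A1 matrix_inv_left invertible_perturbation[OF R small] flip: matrix_mul_assoc)
  then have A1T: "transpose (A + E\<^sub>A) = transpose (R\<^sub>s + E\<^sub>s) ** transpose A\<^sub>1"
    by (metis matrix_transpose_mul)
  have "transpose A\<^sub>1 *v ((A + E\<^sub>A) *v xh - b) = 0"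
    using xh by (simp only: A2 matrix_vector_mult_diff_distrib matrix_vector_mul_assoc
        right_minus_eq)
  then have perturbed: "transpose (A + E\<^sub>A) *v ((A + E\<^sub>A) *v xh - b) = 0"
    by (simp only: A1T matrix_vector_mul_assoc[symmetric] matrix_vector_mult_0_right)
  have err: "norm (xh - x) \<le> ?c * ?e * (?p * norm xh + spectral_norm ?P * (?t + ?e * norm xh))"
    using normal_equations_error_bound[of A ?P x b E\<^sub>A xh] injB x perturbed by (simp add: Ap)
  have "A = A\<^sub>p ** R\<^sub>s"
    by (simp add: Ap matrix_inv_left R flip: matrix_mul_assoc)
  then have aR: "?a \<le> ?p * spectral_norm R\<^sub>s"
    by (metis spectral_norm_mult)
  have "?P = pinv A ** A\<^sub>p"
    by (simp add: Ap matrix_mul_assoc pinv_left_inverse injA)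
  then have P: "spectral_norm ?P \<le> spectral_norm (pinv A) * ?p"
    by (metis spectral_norm_mult)
  have bound: "norm (xh - x) / norm xh \<le> cond_num ?B * \<nu> * \<epsilon>\<^sub>A *
      (cond_num R\<^sub>s * (?t / (?a * norm xh)) + 1 + cond_num A * \<epsilon>\<^sub>A)" if "xh \<noteq> 0"
  proof -
    let ?x = "norm xh"
    have x0: "0 < ?x"
      using that by simp
    \<comment> \<open>The bound \<open>aR\<close> provides the factor
      \<open>spectral_norm R\<^sub>s\<close> that completes the norm of \<open>?P\<close> to
      \<open>cond_num R\<^sub>s\<close>, at the cost of \<open>?p / ?a\<close>.\<close>
    have "spectral_norm ?P * ?t \<le> ?p * cond_num R\<^sub>s * (?t / ?a)"
    proof -
      have "?a * (spectral_norm ?P * ?t) \<le> ?p * spectral_norm R\<^sub>s * (spectral_norm ?P * ?t)"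
        by (intro mult_right_mono aR mult_nonneg_nonneg spectral_norm_nonneg norm_ge_zero)
      then show ?thesis
        using a by (simp add: cond_num_def pinv_eq_matrix_inv[OF R] field_simps)
    qed
    \<comment> \<open>Here the norm of \<open>?P\<close> is instead bounded through
      \<open>pinv A\<close>; writing \<open>?e\<close> as \<open>?a * \<epsilon>\<^sub>A\<close>
      then produces \<open>cond_num A\<close>.\<close>
    moreover have "spectral_norm ?P * (?e * ?x) \<le> ?p * cond_num A * \<epsilon>\<^sub>A * ?x"
    proof -
      have "spectral_norm ?P * (?e * ?x) \<le> spectral_norm (pinv A) * ?p * (?e * ?x)"
        by (intro mult_right_mono P mult_nonneg_nonneg spectral_norm_nonneg norm_ge_zero)
      then show ?thesis
        using a by (simp add: cond_num_def epsA ac_simps)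
    qed
    ultimately have "?p * ?x + spectral_norm ?P * (?t + ?e * ?x)
        \<le> ?p * ?x + (?p * cond_num R\<^sub>s * (?t / ?a) + ?p * cond_num A * \<epsilon>\<^sub>A * ?x)"
      unfolding distrib_left by linarith
    then have "norm (xh - x) \<le> ?c * ?e *
        (?p * ?x + (?p * cond_num R\<^sub>s * (?t / ?a) + ?p * cond_num A * \<epsilon>\<^sub>A * ?x))"
      by (intro order_trans[OF err] mult_left_mono mult_nonneg_nonneg spectral_norm_nonneg)
    also have "\<dots> = ?c * ?e * ?p * (cond_num R\<^sub>s * (?t / (?a * ?x)) + 1 + cond_num A * \<epsilon>\<^sub>A) * ?x"
      using x0 a by (simp add: field_simps)
    \<comment> \<open>On the right, the norm of \<open>?B\<close> cancels between
      \<open>cond_num ?B\<close> and \<open>\<nu>\<close>, and \<open>?a\<close> cancels between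
      \<open>\<nu>\<close> and \<open>\<epsilon>\<^sub>A\<close>.\<close>
    also have "?c * ?e * ?p = cond_num ?B * \<nu> * \<epsilon>\<^sub>A"
      using a B by (simp add: cond_num_def[of ?B] nu epsA)
    finally show ?thesis
      using x0 by (simp add: pos_divide_le_eq)
  qed
  show ?thesis
    using bound nu1 by blast
qed

end
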